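(* For every even positive integer $n$, there are infinitely many integral trees of diameter $2n+1$.
   Context: A graph is integral if all eigenvalues of its adjacency matrix are integers. *)

theory Defs
  imports "Jordan_Normal_Form.Char_Poly"
begin

definition graph_on :: "nat \<Rightarrow> (nat \<Rightarrow> nat \<Rightarrow> bool) \<Rightarrow> bool" where
  "graph_on m E \<longleftrightarrow> (\<forall>u v. E u v \<longrightarrow> u < m \<and> v < m) \<and>
                     (\<forall>u v. E u v \<longrightarrow> E v u) \<and> (\<forall>u. \<not> E u u)"

definition walk :: "(nat \<Rightarrow> nat \<Rightarrow> bool) \<Rightarrow> nat list \<Rightarrow> bool" where
  "walk E xs \<longleftrightarrow> xs \<noteq> [] \<and> (\<forall>i. Suc i < length xs \<longrightarrow> E (xs ! i) (xs ! Suc i))"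

definition connected_graph :: "nat \<Rightarrow> (nat \<Rightarrow> nat \<Rightarrow> bool) \<Rightarrow> bool" where
  "connected_graph m E \<longleftrightarrow>
     (\<forall>u v. u < m \<and> v < m \<longrightarrow> (\<exists>xs. walk E xs \<and> hd xs = u \<and> last xs = v))"

definition has_cycle :: "(nat \<Rightarrow> nat \<Rightarrow> bool) \<Rightarrow> bool" where
  "has_cycle E \<longleftrightarrow> (\<exists>xs. walk E xs \<and> distinct xs \<and> length xs \<ge> 3 \<and> E (last xs) (hd xs))"

definition is_tree :: "nat \<Rightarrow> (nat \<Rightarrow> nat \<Rightarrow> bool) \<Rightarrow> bool" where
  "is_tree m E \<longleftrightarrow> graph_on m E \<and> m \<ge> 1 \<and> connected_graph m E \<and> \<not> has_cycle E"

definition gdist :: "(nat \<Rightarrow> nat \<Rightarrow> bool) \<Rightarrow> nat \<Rightarrow> nat \<Rightarrow> nat" where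
  "gdist E u v = (LEAST k. \<exists>xs. walk E xs \<and> hd xs = u \<and> last xs = v \<and> length xs = Suc k)"

definition diameter :: "nat \<Rightarrow> (nat \<Rightarrow> nat \<Rightarrow> bool) \<Rightarrow> nat" where
  "diameter m E = Max {gdist E u v | u v. u < m \<and> v < m}"

definition adj_matrix :: "nat \<Rightarrow> (nat \<Rightarrow> nat \<Rightarrow> bool) \<Rightarrow> complex mat" where
  "adj_matrix m E = mat m m (\<lambda>(i, j). if E i j then 1 else 0)"

definition integral_graph :: "nat \<Rightarrow> (nat \<Rightarrow> nat \<Rightarrow> bool) \<Rightarrow> bool" where
  "integral_graph m E \<longleftrightarrow> (\<forall>k. eigenvalue (adj_matrix m E) k \<longrightarrow> k \<in> \<int>)"

definition graph_iso :: "nat \<times> (nat \<Rightarrow> nat \<Rightarrow> bool) \<Rightarrow> nat \<times> (nat \<Rightarrow> nat \<Rightarrow> bool) \<Rightarrow> bool" where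
  "graph_iso G H \<longleftrightarrow> (\<exists>f. bij_betw f {..<fst G} {..<fst H} \<and>
      (\<forall>u<fst G. \<forall>v<fst G. snd G u v \<longleftrightarrow> snd H (f u) (f v)))"

end

theory Submission
  imports Defs
begin

text \<open>The ratio of a rooted tree at \<open>x\<close> is its characteristic polynomial divided by that of the
  tree with the root deleted; it equals \<open>x\<close> minus the sum of the reciprocals of the ratios of the
  branches at the root. If no branch has ratio \<open>0\<close> at \<open>x\<close> and neither has the whole tree, then \<open>x\<close> is
  not an eigenvalue.

  For \<open>0 < a\<^sub>1 < a\<^sub>2 < \<dots>\<close> let \<open>C\<^sub>0\<close> be a point, \<open>C\<^sub>1\<close> a star with \<open>a\<^sub>1\<close> leaves, and obtain \<open>C\<^sub>k\<close>
  by joining the root of \<open>C\<^bsub>k-2\<^esub>\<close> to the roots of \<open>a\<^sub>k - a\<^bsub>k-1\<^esub>\<close> copies of \<open>C\<^bsub>k-1\<^esub>\<close>; these are the trees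
  of Csikvari. The ratios satisfy \<open>f\<^bsub>k-1\<^esub> f\<^sub>k = t - a\<^sub>k\<close> with \<open>t = x\<^sup>2\<close>. Hence prepending a new first
  term \<open>d\<close> to the sequence changes the ratio, up to an index shift, only by the factor
  \<open>(t - d) / t\<close> or its inverse, depending on the parity of the index.

  For even \<open>n\<close> take \<open>a\<^bsub>n-1\<^esub> = A\<^sup>2\<close> and join the root of \<open>C\<^bsub>n-1\<^esub>(4, a\<^sub>1, \<dots>)\<close> to the roots of \<open>c\<close> copies of
  \<open>C\<^bsub>n-1\<^esub>(a\<^sub>1, \<dots>)\<close> and of one copy of \<open>C\<^sub>n(b, a\<^sub>1, \<dots>)\<close>. This tree has diameter \<open>2n + 1\<close>, and its ratio
  vanishes only if \<open>(t - A\<^sup>2)(t - 4) = (c + 1) t - b\<close>. With \<open>A = k(k + 1)\<close>, \<open>b = 4A + 1 = (2k + 1)\<^sup>2\<close> and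
  \<open>c = 3A\<^sup>2 + 4A - 3\<close> the solutions are \<open>t = 1\<close> and \<open>t = (2A + 1)\<^sup>2\<close>, so if all \<open>a\<^sub>i\<close> are squares, then
  all eigenvalues are integers.\<close>

section \<open>Walks as relational powers\<close>

lemma walk_Cons_Cons: "walk E (u # v # xs) \<longleftrightarrow> E u v \<and> walk E (v # xs)"
  unfolding walk_def by (auto simp: nth_Cons less_Suc_eq_0_disj split: nat.splits)

text \<open>A list of \<open>Suc k\<close> vertices makes \<open>k\<close> steps. Relational powers
  give concatenation and reversal of walks without list manipulation.\<close>

lemma walk_iff_relpowp:
  "(\<exists>xs. walk E xs \<and> hd xs = u \<and> last xs = v \<and> length xs = Suc k) \<longleftrightarrow> (E ^^ k) u v"
proof (induction k arbitrary: u)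
  case 0
  have "walk E [u]" by (simp add: walk_def)
  then show ?case by (auto simp: length_Suc_conv intro: exI[of _ "[u]"])
next
  case (Suc k)
  have "(\<exists>xs. walk E xs \<and> hd xs = u \<and> last xs = v \<and> length xs = Suc (Suc k)) \<longleftrightarrow>
      (\<exists>w. E u w \<and> (\<exists>xs. walk E xs \<and> hd xs = w \<and> last xs = v \<and> length xs = Suc k))"
    (is "?L \<longleftrightarrow> ?R")
  proof
    assume ?L
    then obtain w ys where "walk E (u # w # ys)" "last (u # w # ys) = v" "length ys = k"
      by (auto simp: length_Suc_conv)
    then have "E u w" "walk E (w # ys) \<and> hd (w # ys) = w \<and> last (w # ys) = v \<and> length (w # ys) = Suc k"
      by (auto simp: walk_Cons_Cons)
    then show ?R by blast
  next
    assume ?R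
    then obtain w ys where "E u w" "walk E (w # ys)" "last (w # ys) = v" "length ys = k"
      by (auto simp: length_Suc_conv)
    then show ?L by (intro exI[of _ "u # w # ys"]) (auto simp: walk_Cons_Cons)
  qed
  also have "\<dots> \<longleftrightarrow> (E ^^ Suc k) u v"
    unfolding Suc.IH by (meson relpowp_Suc_E2 relpowp_Suc_I2)
  finally show ?case .
qed

lemma gdist_eq_Least_relpowp: "gdist E u v = (LEAST k. (E ^^ k) u v)"
  unfolding gdist_def walk_iff_relpowp ..

lemma connected_graph_iff_rtranclp:
  "connected_graph m E \<longleftrightarrow> (\<forall>u<m. \<forall>v<m. E\<^sup>*\<^sup>* u v)"
proof -
  have "(\<exists>xs. walk E xs \<and> hd xs = u \<and> last xs = v) \<longleftrightarrow> E\<^sup>*\<^sup>* u v" for u v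
  proof -
    have "(\<exists>xs. walk E xs \<and> hd xs = u \<and> last xs = v) \<longleftrightarrow>
        (\<exists>k xs. walk E xs \<and> hd xs = u \<and> last xs = v \<and> length xs = Suc k)"
      by (metis walk_def length_0_conv not0_implies_Suc)
    then show ?thesis by (simp add: walk_iff_relpowp rtranclp_power)
  qed
  then show ?thesis unfolding connected_graph_def by blast
qed

lemma relpowp_sym:
  assumes "\<And>u v. E u v \<Longrightarrow> E v u" "(E ^^ k) u v"
  shows "(E ^^ k) v u"
  using assms(2)
proof (induction k arbitrary: v)
  case (Suc k)
  then obtain w where "(E ^^ k) u w" "E w v" by (auto elim: relpowp_Suc_E)
  then show ?case using Suc.IH assms(1) by (meson relpowp_Suc_I2)
qed simp

lemma relpowp_trans: "(E ^^ i) u v \<Longrightarrow> (E ^^ j) v w \<Longrightarrow> (E ^^ (i + j)) u w"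
  by (auto simp: relpowp_add)

lemma abs_diff_le_of_relpowp:
  fixes h :: "'a \<Rightarrow> int"
  assumes "\<And>u v. E u v \<Longrightarrow> \<bar>h u - h v\<bar> \<le> 1" "(E ^^ k) u v"
  shows "\<bar>h u - h v\<bar> \<le> int k"
  using assms(2)
proof (induction k arbitrary: v)
  case (Suc k)
  then obtain w where "(E ^^ k) u w" "E w v" by (auto elim: relpowp_Suc_E)
  then show ?case using Suc.IH[of w] assms(1)[of w v] by simp
qed simp

text \<open>Following parents lowers \<open>\<delta>\<close> by one per step, and within
  \<open>I\<close> only \<open>r\<close> can have value 0. The set \<open>I\<close> lets this apply
  to each half of a grafted tree separately.\<close>

lemma relpowp_to_root:
  assumes "\<delta> r = (0::nat)"
    and "\<And>i. i \<in> I \<Longrightarrow> i \<noteq> r \<Longrightarrow> p i \<in> I \<and> E i (p i) \<and> \<delta> i = Suc (\<delta> (p i))"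
    and "i \<in> I"
  shows "(E ^^ \<delta> i) i r"
  using \<open>i \<in> I\<close>
proof (induction "\<delta> i" arbitrary: i)
  case 0
  then show ?case using assms(2)[of i] by fastforce
next
  case (Suc k)
  then have "i \<noteq> r" using assms(1) by auto
  then show ?case using Suc assms(2)[of i] by (metis nat.inject relpowp_Suc_I2)
qed

section \<open>Trees given by parent functions\<close>

text \<open>A rooted tree is a pair \<open>(m, p)\<close>: the vertices are \<open>0, \<dots>, m - 1\<close>, the root is \<open>0\<close> and
  \<open>p i < i\<close> is the parent of \<open>i > 0\<close>; the value \<open>p 0\<close> is irrelevant.\<close>

type_synonym ptree = "nat \<times> (nat \<Rightarrow> nat)"

definition ptree :: "ptree \<Rightarrow> bool" where
  "ptree T \<longleftrightarrow> 0 < fst T \<and> (\<forall>i. 0 < i \<and> i < fst T \<longrightarrow> snd T i < i)"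

definition tree_edge :: "ptree \<Rightarrow> nat \<Rightarrow> nat \<Rightarrow> bool" where
  "tree_edge T u v \<longleftrightarrow> u < fst T \<and> v < fst T \<and> (0 < u \<and> snd T u = v \<or> 0 < v \<and> snd T v = u)"

lemma tree_edge_sym: "tree_edge T u v \<Longrightarrow> tree_edge T v u"
  by (auto simp: tree_edge_def)

lemma tree_edge_less: "ptree T \<Longrightarrow> tree_edge T u v \<Longrightarrow> v < u \<Longrightarrow> v = snd T u"
  by (force simp: tree_edge_def ptree_def)

lemma tree_edge_parent: "ptree T \<Longrightarrow> 0 < u \<Longrightarrow> u < fst T \<Longrightarrow> tree_edge T u (snd T u)"
  by (force simp: tree_edge_def ptree_def)

lemma tree_edge_irrefl: "ptree T \<Longrightarrow> \<not> tree_edge T u u"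
  by (force simp: tree_edge_def ptree_def)

lemma connected_tree_edge:
  assumes "ptree T"
  shows "connected_graph (fst T) (tree_edge T)"
proof -
  have to_root: "(tree_edge T)\<^sup>*\<^sup>* u 0" if "u < fst T" for u
    using that
  proof (induction u rule: less_induct)
    case (less u)
    show ?case
    proof (cases "u = 0")
      case False
      then have "snd T u < u" "tree_edge T u (snd T u)"
        using less.prems assms tree_edge_parent by (auto simp: ptree_def)
      then show ?thesis
        using less.IH[of "snd T u"] less.prems by (simp add: converse_rtranclp_into_rtranclp)
    qed simp
  qed
  have "symp (tree_edge T)" by (rule sympI) (rule tree_edge_sym)
  then have "(tree_edge T)\<^sup>*\<^sup>* 0 v" if "v < fst T" for v
    using to_root[OF that] by (meson symp_rtranclp sympD)
  then show ?thesis
    unfolding connected_graph_iff_rtranclp using to_root by (meson rtranclp_trans)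
qed

text \<open>The largest vertex of a cycle would have two distinct smaller neighbours, both of which are
  its parent.\<close>

lemma not_has_cycle_tree_edge:
  assumes "ptree T"
  shows "\<not> has_cycle (tree_edge T)"
proof
  assume "has_cycle (tree_edge T)"
  then obtain xs where w: "walk (tree_edge T) xs" and d: "distinct xs" and l: "length xs \<ge> 3"
    and c: "tree_edge T (last xs) (hd xs)" unfolding has_cycle_def by blast
  define L where "L = length xs"
  have ne: "xs \<noteq> []" using l by auto
  \<comment> \<open>Cyclic successor of a position, so that the closing edge is treated like the
    others. The \<open>j\<close> below is the cyclic predecessor of \<open>i\<close>; it differs
    from \<open>s i\<close> because the cycle has at least 3 vertices.\<close>
  define s where "s i = (if Suc i = L then 0 else Suc i)" for i
  have s_less: "s i < L" if "i < L" for i using that l by (auto simp: s_def L_def)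
  have edge: "tree_edge T (xs ! i) (xs ! s i)" if "i < L" for i
  proof (cases "Suc i = L")
    case True
    then have "last xs = xs ! i" using ne by (metis L_def diff_Suc_1 last_conv_nth)
    then show ?thesis using c ne True by (simp add: s_def hd_conv_nth)
  next
    case False
    then show ?thesis using w that by (simp add: walk_def s_def L_def)
  qed
  have "Max (set xs) \<in> set xs" using ne by simp
  then obtain i where i: "i < L" "xs ! i = Max (set xs)" by (auto simp: in_set_conv_nth L_def)
  have eq_parent: "xs ! j = snd T (xs ! i)" if "j < L" "tree_edge T (xs ! i) (xs ! j)" for j
  proof -
    have "xs ! j \<le> xs ! i" using that(1) i by (simp add: L_def)
    moreover have "xs ! j \<noteq> xs ! i" using that(2) tree_edge_irrefl[OF assms] by metis
    ultimately show ?thesis using tree_edge_less[OF assms that(2)] by simp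
  qed
  define j where "j = (if i = 0 then L - 1 else i - 1)"
  have j: "j < L" "s j = i" "s i \<noteq> j" using i(1) l by (auto simp: j_def s_def L_def)
  have "xs ! j = xs ! s i"
    using eq_parent[OF s_less[OF i(1)] edge[OF i(1)]] eq_parent[OF j(1)] edge[OF j(1)] j(2)
    by (simp add: tree_edge_sym)
  then show False using d j s_less[OF i(1)] by (simp add: nth_eq_iff_index_eq L_def)
qed

lemma is_tree_tree_edge:
  assumes "ptree T"
  shows "is_tree (fst T) (tree_edge T)"
proof -
  have "graph_on (fst T) (tree_edge T)"
    unfolding graph_on_def using tree_edge_irrefl[OF assms] tree_edge_sym[of T]
    by (simp add: tree_edge_def)
  then show ?thesis
    using connected_tree_edge[OF assms] not_has_cycle_tree_edge[OF assms] assms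
    by (simp add: is_tree_def ptree_def)
qed

text \<open>Shifting \<open>S\<close> past the vertices of \<open>T\<close> keeps parents smaller
  than children; the root of \<open>S\<close> becomes a child of the root of
  \<open>T\<close>.\<close>

definition graft :: "ptree \<Rightarrow> ptree \<Rightarrow> ptree" where
  "graft T S = (fst T + fst S,
     \<lambda>i. if i < fst T then snd T i else if i = fst T then 0 else fst T + snd S (i - fst T))"

definition graft_copies :: "nat \<Rightarrow> ptree \<Rightarrow> ptree \<Rightarrow> ptree" where
  "graft_copies c T S = ((\<lambda>T. graft T S) ^^ c) T"

lemma graft_copies_0 [simp]: "graft_copies 0 T S = T"
  and graft_copies_Suc [simp]: "graft_copies (Suc c) T S = graft (graft_copies c T S) S"
  by (simp_all add: graft_copies_def)

lemma fst_graft [simp]: "fst (graft T S) = fst T + fst S"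
  by (simp add: graft_def)

lemma fst_graft_copies [simp]: "fst (graft_copies c T S) = fst T + c * fst S"
  by (induction c) simp_all

lemma ptree_graft:
  assumes "ptree T" "ptree S"
  shows "ptree (graft T S)"
proof -
  have "snd (graft T S) i < i" if i: "0 < i" "i < fst T + fst S" for i
  proof (cases "fst T < i")
    case True
    then have "snd S (i - fst T) < i - fst T" using assms(2) i by (simp add: ptree_def)
    then show ?thesis using True by (simp add: graft_def)
  qed (use assms(1) i in \<open>simp add: graft_def ptree_def\<close>)
  then show ?thesis using assms by (simp add: ptree_def)
qed

lemma ptree_graft_copies: "ptree T \<Longrightarrow> ptree S \<Longrightarrow> ptree (graft_copies c T S)"
  by (induction c) (simp_all add: ptree_graft)

section \<open>Depth and diameter\<close>

text \<open>A witness characterised by its recursion, since recursion along \<open>snd T\<close>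
  need not terminate for an arbitrary pair.\<close>

definition depth_fun :: "ptree \<Rightarrow> (nat \<Rightarrow> nat) \<Rightarrow> bool" where
  "depth_fun T \<delta> \<longleftrightarrow> \<delta> 0 = 0 \<and> (\<forall>i. 0 < i \<and> i < fst T \<longrightarrow> \<delta> i = Suc (\<delta> (snd T i)))"

definition has_depth :: "ptree \<Rightarrow> nat \<Rightarrow> bool" where
  "has_depth T d \<longleftrightarrow>
     (\<exists>\<delta>. depth_fun T \<delta> \<and> (\<forall>i<fst T. \<delta> i \<le> d) \<and> (\<exists>i<fst T. \<delta> i = d))"

lemma has_depth_graft:
  assumes "ptree T" "ptree S" "has_depth T d" "has_depth S e"
  shows "has_depth (graft T S) (max d (Suc e))"
proof -
  obtain \<delta> where \<delta>: "depth_fun T \<delta>" "\<forall>i<fst T. \<delta> i \<le> d" "\<exists>i<fst T. \<delta> i = d"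
    using assms(3) by (auto simp: has_depth_def)
  obtain \<epsilon> where \<epsilon>: "depth_fun S \<epsilon>" "\<forall>i<fst S. \<epsilon> i \<le> e" "\<exists>i<fst S. \<epsilon> i = e"
    using assms(4) by (auto simp: has_depth_def)
  define \<gamma> where "\<gamma> i = (if i < fst T then \<delta> i else Suc (\<epsilon> (i - fst T)))" for i
  have "\<gamma> i = Suc (\<gamma> (snd (graft T S) i))" if i: "0 < i" "i < fst T + fst S" for i
  proof -
    consider "i < fst T" | "i = fst T" | "fst T < i" by linarith
    then show ?thesis
    proof cases
      case 1
      then have "snd T i < fst T" using assms(1) i by (auto simp: ptree_def)
      then show ?thesis using 1 \<delta>(1) i by (simp add: \<gamma>_def graft_def depth_fun_def)
    next
      case 2
      then show ?thesis using \<delta>(1) \<epsilon>(1) assms(1)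
        by (simp add: \<gamma>_def graft_def depth_fun_def ptree_def)
    next
      case 3
      then have "\<epsilon> (i - fst T) = Suc (\<epsilon> (snd S (i - fst T)))"
        using \<epsilon>(1) i by (simp add: depth_fun_def)
      then show ?thesis using 3 by (simp add: \<gamma>_def graft_def)
    qed
  qed
  then have "depth_fun (graft T S) \<gamma>"
    using \<delta>(1) assms(1) by (simp add: depth_fun_def ptree_def \<gamma>_def)
  moreover have "\<forall>i<fst (graft T S). \<gamma> i \<le> max d (Suc e)"
    using \<delta>(2) \<epsilon>(2) by (auto simp: \<gamma>_def le_max_iff_disj)
  moreover have "\<exists>i<fst (graft T S). \<gamma> i = max d (Suc e)"
  proof (cases "Suc e \<le> d")
    case True
    obtain j where "j < fst T" "\<delta> j = d" using \<delta>(3) by blast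
    then show ?thesis using True by (intro exI[of _ j]) (simp add: \<gamma>_def)
  next
    case False
    obtain j where "j < fst S" "\<epsilon> j = e" using \<epsilon>(3) by blast
    then show ?thesis using False by (intro exI[of _ "fst T + j"]) (simp add: \<gamma>_def)
  qed
  ultimately show ?thesis unfolding has_depth_def by blast
qed

lemma has_depth_graft_copies:
  assumes "ptree T" "ptree S" "has_depth T d" "has_depth S e" "d \<le> Suc e" "0 < c"
  shows "has_depth (graft_copies c T S) (Suc e)"
proof -
  have "has_depth (graft_copies (Suc c) T S) (Suc e)" for c
  proof (induction c)
    case 0
    then show ?case using has_depth_graft[OF assms(1-4)] assms(5) by (simp add: max_absorb2)
  next
    case (Suc c)
    then show ?case
      using has_depth_graft[OF ptree_graft_copies[OF assms(1,2)] assms(2) Suc.IH assms(4)] by simp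
  qed
  then show ?thesis using assms(6) by (metis gr0_implies_Suc)
qed

text \<open>Every vertex is within \<open>d\<close> of the root of its half, and the edge between
  the roots adds 1. Deepest vertices of the two halves attain the bound.\<close>

lemma diameter_graft:
  assumes "ptree T" "ptree S" "has_depth T d" "has_depth S d"
  shows "diameter (fst (graft T S)) (tree_edge (graft T S)) = 2 * d + 1"
proof -
  obtain \<delta> where \<delta>: "depth_fun T \<delta>" "\<forall>i<fst T. \<delta> i \<le> d" "\<exists>i<fst T. \<delta> i = d"
    using assms(3) by (auto simp: has_depth_def)
  obtain \<epsilon> where \<epsilon>: "depth_fun S \<epsilon>" "\<forall>i<fst S. \<epsilon> i \<le> d" "\<exists>i<fst S. \<epsilon> i = d"
    using assms(4) by (auto simp: has_depth_def)
  define m where "m = fst T"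
  define G where "G = graft T S"
  define E where "E = tree_edge G"
  have G: "ptree G" and [simp]: "fst G = m + fst S"
    using assms by (simp_all add: G_def ptree_graft m_def)
  have pos: "0 < m" "0 < fst S" using assms by (auto simp: ptree_def m_def)
  have sym: "E u v \<Longrightarrow> E v u" for u v by (simp add: E_def tree_edge_sym)
  have rev: "(E ^^ k) v u" if "(E ^^ k) u v" for k u v
    by (rule relpowp_sym[of E, OF _ that]) (rule sym)
  have T: "(E ^^ \<delta> i) i 0" if "i < m" for i
  proof (rule relpowp_to_root[where I = "{..<m}" and p = "snd G"])
    show "\<delta> 0 = 0" using \<delta>(1) by (simp add: depth_fun_def)
    fix i assume i: "i \<in> {..<m}" "i \<noteq> 0"
    then have "snd G i = snd T i" "snd T i < i"
      using assms(1) by (auto simp: G_def graft_def m_def ptree_def)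
    then show "snd G i \<in> {..<m} \<and> E i (snd G i) \<and> \<delta> i = Suc (\<delta> (snd G i))"
      using tree_edge_parent[OF G, of i] i \<delta>(1) by (auto simp: E_def depth_fun_def m_def)
  qed (use that in simp)
  have S: "(E ^^ \<epsilon> (i - m)) i m" if "m \<le> i" "i < m + fst S" for i
  proof (rule relpowp_to_root[where I = "{m..<m + fst S}" and p = "snd G" and \<delta> = "\<lambda>i. \<epsilon> (i - m)"])
    show "\<epsilon> (m - m) = 0" using \<epsilon>(1) by (simp add: depth_fun_def)
    fix i assume i: "i \<in> {m..<m + fst S}" "i \<noteq> m"
    then have "snd G i = m + snd S (i - m)" "snd S (i - m) < i - m"
      using assms(2) by (auto simp: G_def graft_def m_def ptree_def)
    then show "snd G i \<in> {m..<m + fst S} \<and> E i (snd G i) \<and> \<epsilon> (i - m) = Suc (\<epsilon> (snd G i - m))"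
      using tree_edge_parent[OF G, of i] i \<epsilon>(1) pos by (auto simp: E_def depth_fun_def)
  qed (use that in simp)
  have "E 0 m" using pos by (simp add: E_def tree_edge_def G_def graft_def m_def)
  have near: "\<exists>k \<le> 2 * d + 1. (E ^^ k) u v" if uv: "u < m + fst S" "v < m + fst S" for u v
  proof -
    have via: "\<exists>k\<le>2 * d + 1. (E ^^ k) u v"
      if "(E ^^ i) u r" "(E ^^ j) v r" "i \<le> d" "j \<le> d" for u v r i j
      using relpowp_trans[OF that(1) rev[OF that(2)]] that(3,4)
      by (intro exI[of _ "i + j"]) simp
    have cross: "\<exists>k\<le>2 * d + 1. (E ^^ k) u v"
      if "(E ^^ i) u 0" "(E ^^ j) v m" "i \<le> d" "j \<le> d" for u v i j
      using relpowp_trans[OF relpowp_Suc_I[OF that(1) \<open>E 0 m\<close>] rev[OF that(2)]] that(3,4)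
      by (intro exI[of _ "Suc i + j"]) simp
    have bT: "\<delta> i \<le> d" if "i < m" for i using that \<delta>(2) by (simp add: m_def)
    have bS: "\<epsilon> (i - m) \<le> d" if "m \<le> i" "i < m + fst S" for i using that \<epsilon>(2) by simp
    consider "u < m" "v < m" | "u < m" "m \<le> v" | "m \<le> u" "v < m" | "m \<le> u" "m \<le> v" by linarith
    then show ?thesis
    proof cases
      case 1
      then show ?thesis using via[OF T T] bT by simp
    next
      case 2
      then show ?thesis using cross[OF T S] bT bS uv by simp
    next
      case 3
      then obtain k where "k \<le> 2 * d + 1" "(E ^^ k) v u" using cross[OF T S, of v u] bT bS uv by auto
      then show ?thesis using rev by blast
    next
      case 4
      then show ?thesis using via[OF S S] bS uv by simp
    qed
  qed
  have upper: "gdist E u v \<le> 2 * d + 1" if "u < m + fst S" "v < m + fst S" for u v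
    using near[OF that] unfolding gdist_eq_Least_relpowp by (meson Least_le order_trans)
  text \<open>A height function changing by one along every edge bounds distances from below.\<close>
  define h where "h i = (if i < m then int (\<delta> i) else - 1 - int (\<epsilon> (i - m)))" for i
  have h_parent: "\<bar>h i - h (snd G i)\<bar> \<le> 1" if i: "0 < i" "i < m + fst S" for i
  proof -
    consider "i < m" | "i = m" | "m < i" by linarith
    then show ?thesis
    proof cases
      case 1
      then have "snd T i < m" using assms(1) i by (auto simp: ptree_def m_def)
      then show ?thesis using 1 \<delta>(1) i by (simp add: h_def G_def graft_def depth_fun_def m_def)
    next
      case 2
      then show ?thesis using \<delta>(1) \<epsilon>(1) pos by (simp add: h_def G_def graft_def depth_fun_def m_def)
    next
      case 3
      then have "\<epsilon> (i - m) = Suc (\<epsilon> (snd S (i - m)))"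
        using \<epsilon>(1) i by (simp add: depth_fun_def)
      then show ?thesis using 3 by (simp add: h_def G_def graft_def m_def)
    qed
  qed
  have h_edge: "\<bar>h u - h v\<bar> \<le> 1" if "E u v" for u v
    using that h_parent[of u] h_parent[of v] by (auto simp: E_def tree_edge_def)
  obtain i j where i: "i < m" "\<delta> i = d" and j: "j < fst S" "\<epsilon> j = d"
    using \<delta>(3) \<epsilon>(3) by (auto simp: m_def)
  have "(E ^^ gdist E i (m + j)) i (m + j)"
    unfolding gdist_eq_Least_relpowp using near[of i "m + j"] i j by (auto intro: LeastI)
  from abs_diff_le_of_relpowp[of E h, OF h_edge this]
  have "2 * d + 1 \<le> gdist E i (m + j)" using i j by (simp add: h_def)
  then have far: "gdist E i (m + j) = 2 * d + 1" using upper[of i "m + j"] i j by simp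
  let ?D = "{gdist E u v | u v. u < m + fst S \<and> v < m + fst S}"
  have "?D \<subseteq> {..2 * d + 1}" using upper by auto
  moreover have "2 * d + 1 \<in> ?D"
    unfolding far[symmetric] using i j
    by - (rule CollectI, rule exI[of _ i], rule exI[of _ "m + j"], simp)
  ultimately have "Max ?D = 2 * d + 1"
    by (intro Max_eqI) (auto intro: finite_subset)
  then show ?thesis by (simp add: diameter_def E_def G_def m_def)
qed

section \<open>Characteristic ratios and eigenvalues\<close>

text \<open>The witness \<open>g i\<close> is the ratio of the branch rooted at \<open>i\<close>. Only the ratio at the root may vanish,
  so no junk value of division by zero enters.\<close>

definition has_ratio :: "complex \<Rightarrow> ptree \<Rightarrow> complex \<Rightarrow> bool" where
  "has_ratio x T f \<longleftrightarrow> (\<exists>g. g 0 = f \<and> (\<forall>i. 0 < i \<and> i < fst T \<longrightarrow> g i \<noteq> 0) \<and>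
     (\<forall>i<fst T. g i = x - (\<Sum>j | 0 < j \<and> j < fst T \<and> snd T j = i. 1 / g j)))"

lemma has_ratio_single: "has_ratio x (1, p) x"
  unfolding has_ratio_def by (rule exI[of _ "\<lambda>_. x"]) auto

text \<open>Only the root of \<open>T\<close> gains a child, so all other ratios persist. The root
  of \<open>S\<close> becomes a non-root vertex, hence \<open>f' \<noteq> 0\<close>.\<close>

lemma has_ratio_graft:
  assumes "ptree T" "ptree S" "has_ratio x T f" "has_ratio x S f'" "f' \<noteq> 0"
  shows "has_ratio x (graft T S) (f - 1 / f')"
proof -
  obtain g where g: "g 0 = f" "\<forall>i. 0 < i \<and> i < fst T \<longrightarrow> g i \<noteq> 0"
     "\<forall>i<fst T. g i = x - (\<Sum>j | 0 < j \<and> j < fst T \<and> snd T j = i. 1 / g j)"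
    using assms(3) unfolding has_ratio_def by blast
  obtain g' where g': "g' 0 = f'" "\<forall>i. 0 < i \<and> i < fst S \<longrightarrow> g' i \<noteq> 0"
     "\<forall>i<fst S. g' i = x - (\<Sum>j | 0 < j \<and> j < fst S \<and> snd S j = i. 1 / g' j)"
    using assms(4) unfolding has_ratio_def by blast
  define m where "m = fst T"
  define G where "G = graft T S"
  have pos: "0 < m" "0 < fst S" using assms by (auto simp: ptree_def m_def)
  define h where "h i = (if i = 0 then f - 1 / f' else if i < m then g i else g' (i - m))" for i
  have "h i = x - (\<Sum>j | 0 < j \<and> j < m + fst S \<and> snd G j = i. 1 / h j)" if i: "i < m + fst S" for i
  proof (cases "i < m")
    case True
    let ?C = "{j. 0 < j \<and> j < m \<and> snd T j = i}"
    have "{j. 0 < j \<and> j < m + fst S \<and> snd G j = i} = ?C \<union> (if i = 0 then {m} else {})"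
      using True pos by (auto simp: G_def graft_def m_def split: if_splits)
    moreover have "m \<notin> ?C" by simp
    moreover have "(\<Sum>j\<in>?C. 1 / h j) = (\<Sum>j\<in>?C. 1 / g j)"
      by (rule sum.cong) (auto simp: h_def)
    moreover have "g i = x - (\<Sum>j\<in>?C. 1 / g j)" using g(3) True by (simp add: m_def)
    ultimately show ?thesis using True pos g(1) g'(1) by (auto simp: h_def)
  next
    case False
    let ?C = "{j. 0 < j \<and> j < fst S \<and> snd S j = i - m}"
    have "{j. 0 < j \<and> j < m + fst S \<and> snd G j = i} = (+) m ` ?C"
    proof (intro equalityI subsetI)
      fix j assume j: "j \<in> {j. 0 < j \<and> j < m + fst S \<and> snd G j = i}"
      have "m < j"
      proof (rule ccontr)
        assume "\<not> m < j"
        then have "snd G j < m" using j pos assms(1)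
          by (cases "j = m") (force simp: G_def graft_def m_def ptree_def)+
        then show False using j False by simp
      qed
      then show "j \<in> (+) m ` ?C"
        using j False by (intro image_eqI[of _ _ "j - m"]) (auto simp: G_def graft_def m_def)
    qed (use False in \<open>auto simp: G_def graft_def m_def\<close>)
    then have "(\<Sum>j | 0 < j \<and> j < m + fst S \<and> snd G j = i. 1 / h j) = (\<Sum>j\<in>?C. 1 / h (m + j))"
      by (simp add: sum.reindex)
    also have "\<dots> = (\<Sum>j\<in>?C. 1 / g' j)"
      by (rule sum.cong) (auto simp: h_def)
    finally show ?thesis using g'(3) False i pos by (auto simp: h_def)
  qed
  moreover have "h i \<noteq> 0" if "0 < i" "i < m + fst S" for i
    using that g(2) g'(1,2) assms(5) pos by (cases "i = m") (auto simp: h_def m_def)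
  moreover have "h 0 = f - 1 / f'" by (simp add: h_def)
  ultimately show ?thesis
    unfolding has_ratio_def by (intro exI[of _ h]) (simp add: G_def m_def)
qed

lemma has_ratio_graft_copies:
  assumes "ptree T" "ptree S" "has_ratio x T f" "has_ratio x S f'" "f' \<noteq> 0"
  shows "has_ratio x (graft_copies c T S) (f - of_nat c / f')"
proof (induction c)
  case (Suc c)
  have eq: "f - of_nat (Suc c) / f' = f - of_nat c / f' - 1 / f'" by (simp add: add_divide_distrib)
  show ?case
    unfolding eq graft_copies_Suc
    by (rule has_ratio_graft[OF ptree_graft_copies[OF assms(1,2)] assms(2) Suc.IH assms(4,5)])
qed (use assms in simp)

text \<open>Working upwards from the leaves, the entry of an eigenvector at a vertex is the entry at the
  parent divided by the ratio of the branch.\<close>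

lemma not_eigenvalue_if_has_ratio:
  assumes T: "ptree T" and "has_ratio x T f" "f \<noteq> 0"
  shows "\<not> eigenvalue (adj_matrix (fst T) (tree_edge T)) x"
proof
  assume "eigenvalue (adj_matrix (fst T) (tree_edge T)) x"
  define m where "m = fst T"
  define p where "p = snd T"
  define A where "A = adj_matrix m (tree_edge T)"
  define C where "C i = {j. 0 < j \<and> j < m \<and> p j = i}" for i
  obtain g where g: "g 0 = f" "\<And>i. 0 < i \<Longrightarrow> i < m \<Longrightarrow> g i \<noteq> 0"
     "\<And>i. i < m \<Longrightarrow> g i = x - (\<Sum>j\<in>C i. 1 / g j)"
    using assms(2) unfolding has_ratio_def m_def p_def C_def by blast
  have p: "p i < i" if "0 < i" "i < m" for i using T that by (simp add: ptree_def p_def m_def)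
  have dims: "A \<in> carrier_mat m m" by (simp add: A_def adj_matrix_def)
  obtain v where v: "v \<in> carrier_vec m" "v \<noteq> 0\<^sub>v m" "A *\<^sub>v v = x \<cdot>\<^sub>v v"
    using \<open>eigenvalue _ _\<close> dims unfolding eigenvalue_def eigenvector_def
    by (auto simp: A_def m_def)
  have finC: "finite (C i)" for i unfolding C_def by simp
  \<comment> \<open>The eigenvalue equation at \<open>i\<close>, with the neighbours split into
    parent and children.\<close>
  have row: "x * v $ i = (if 0 < i then v $ p i else 0) + (\<Sum>j\<in>C i. v $ j)" if i: "i < m" for i
  proof -
    have "x * v $ i = (A *\<^sub>v v) $ i" using v i by simp
    also have "\<dots> = (\<Sum>j<m. (if tree_edge T i j then 1 else 0) * v $ j)"
      using v(1) dims i by (simp add: scalar_prod_def A_def adj_matrix_def lessThan_atLeast0)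
    also have "\<dots> = (\<Sum>j | j < m \<and> tree_edge T i j. v $ j)"
      by (simp add: sum.If_cases if_distrib[of "\<lambda>c. c * _"] Int_def cong: if_cong)
    also have "{j. j < m \<and> tree_edge T i j} = (if 0 < i then {p i} else {}) \<union> C i"
      using i p[of i] by (auto simp: C_def tree_edge_def m_def p_def)
    also have "(\<Sum>j\<in>\<dots>. v $ j) = (if 0 < i then v $ p i else 0) + (\<Sum>j\<in>C i. v $ j)"
    proof (cases "0 < i")
      case True
      have "p i \<notin> C i" using p[of "p i"] p[OF True i] by (auto simp: C_def)
      then show ?thesis using True finC by simp
    qed simp
    finally show ?thesis .
  qed
  have key: "g i * v $ i = (if 0 < i then v $ p i else 0)"
    if i: "i < m" and "\<forall>j\<in>C i. g j * v $ j = v $ i" for i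
  proof -
    have "v $ j = v $ i * (1 / g j)" if "j \<in> C i" for j
    proof -
      have "g j \<noteq> 0" using that g(2)[of j] by (auto simp: C_def)
      moreover have "g j * v $ j = v $ i" using that \<open>\<forall>j\<in>C i. _\<close> by blast
      ultimately show ?thesis by (simp add: field_simps)
    qed
    then have "(\<Sum>j\<in>C i. v $ j) = v $ i * (\<Sum>j\<in>C i. 1 / g j)"
      by (simp add: sum_distrib_left)
    with row[OF i]
    have eq: "x * v $ i = (if 0 < i then v $ p i else 0) + v $ i * (\<Sum>j\<in>C i. 1 / g j)"
      by (simp only:)
    have "(x - s) * y = w" if "x * y = w + y * s" for s y w :: complex
      using that by (simp add: algebra_simps)
    from this[OF eq] show ?thesis unfolding g(3)[OF i] .
  qed
  \<comment> \<open>Children have larger numbers, so induction on \<open>m - i\<close> proceeds from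
    the leaves towards the root.\<close>
  have up: "\<forall>i. 0 < i \<and> i < m \<and> m - i \<le> k \<longrightarrow> g i * v $ i = v $ p i" for k
  proof (induction k)
    case (Suc k)
    show ?case
    proof (intro allI impI)
      fix i assume i: "0 < i \<and> i < m \<and> m - i \<le> Suc k"
      have "g j * v $ j = v $ i" if "j \<in> C i" for j
      proof -
        have j: "0 < j" "j < m" "p j = i" using that by (auto simp: C_def)
        then have "m - j \<le> k" using i p[of j] by linarith
        then show ?thesis using Suc.IH j by auto
      qed
      then show "g i * v $ i = v $ p i" using key[of i] i by simp
    qed
  qed auto
  have up: "g i * v $ i = v $ p i" if "0 < i" "i < m" for i using up[of m] that by simp
  have "0 < m" using T by (simp add: ptree_def m_def)
  \<comment> \<open>At the root \<open>key\<close> gives \<open>f * v $ 0 = 0\<close>; the vanishing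
    then spreads from parents to children.\<close>
  have zero: "v $ i = 0" if "i < m" for i
    using that
  proof (induction i rule: less_induct)
    case (less i)
    show ?case
    proof (cases "i = 0")
      case True
      then show ?thesis using key[of 0] up \<open>0 < m\<close> g(1) assms(3) by (auto simp: C_def)
    next
      case False
      then show ?thesis using up[of i] less p[of i] g(2)[of i] by simp
    qed
  qed
  have "v = 0\<^sub>v m" using v(1) zero by (intro eq_vecI) auto
  then show False using v(2) by simp
qed

section \<open>Csikvari's trees\<close>

fun csik :: "(nat \<Rightarrow> nat) \<Rightarrow> nat \<Rightarrow> ptree" where
  "csik a 0 = (1, \<lambda>_. 0)"
| "csik a (Suc 0) = graft_copies (a 1) (1, \<lambda>_. 0) (1, \<lambda>_. 0)"
| "csik a (Suc (Suc k)) = graft_copies (a (Suc (Suc k)) - a (Suc k)) (csik a k) (csik a (Suc k))"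

text \<open>The value predicted by the grafting rule; \<open>has_ratio_csik\<close> identifies it
  with the ratio of \<open>csik a k\<close> when \<open>x\<close> avoids the square roots of all
  \<open>a j\<close>.\<close>

fun csik_ratio :: "complex \<Rightarrow> (nat \<Rightarrow> nat) \<Rightarrow> nat \<Rightarrow> complex" where
  "csik_ratio x a 0 = x"
| "csik_ratio x a (Suc 0) = x - of_nat (a 1) / x"
| "csik_ratio x a (Suc (Suc k)) =
     csik_ratio x a k - of_nat (a (Suc (Suc k)) - a (Suc k)) / csik_ratio x a (Suc k)"

lemma ptree_single: "ptree (1, p)"
  by (auto simp: ptree_def)

lemma ptree_csik: "ptree (csik a k)"
  by (induction a k rule: csik.induct) (simp_all add: ptree_single ptree_graft_copies del: One_nat_def)

lemma has_depth_single: "has_depth (1, p) 0"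
  unfolding has_depth_def depth_fun_def by (rule exI[of _ "\<lambda>_. 0"]) auto

text \<open>Strict monotonicity makes the number of grafted copies positive, so each step deepens
  the tree by exactly one.\<close>

lemma has_depth_csik:
  assumes "strict_mono a"
  shows "has_depth (csik a k) k"
proof (induction k rule: induct_nat_012)
  case 0
  then show ?case using has_depth_single by simp
next
  case 1
  have "0 < a 1" using strict_monoD[OF assms, of 0 1] by simp
  then show ?case
    using has_depth_graft_copies[OF ptree_single ptree_single has_depth_single has_depth_single]
    by simp
next
  case (ge2 k)
  have "0 < a (Suc (Suc k)) - a (Suc k)" using strict_monoD[OF assms, of "Suc k"] by simp
  then show ?case
    using has_depth_graft_copies[OF ptree_csik ptree_csik ge2] by simp
qed

text \<open>Sequences are indexed from \<open>1\<close>; the entry at \<open>0\<close> is \<open>0\<close> and is replaced, not shifted.\<close>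

definition prepend :: "nat \<Rightarrow> (nat \<Rightarrow> nat) \<Rightarrow> nat \<Rightarrow> nat" where
  "prepend c a j = (if j = 0 then 0 else if j = 1 then c else a (j - 1))"

lemma strict_mono_prepend:
  assumes "strict_mono a" "0 < c" "c < a 1"
  shows "strict_mono (prepend c a)"
  unfolding strict_mono_Suc_iff
proof
  fix j :: nat
  consider "j = 0" | "j = 1" | "1 < j" by linarith
  then show "prepend c a j < prepend c a (Suc j)"
    using assms by cases (auto simp: prepend_def strict_mono_def)
qed

context
  fixes x :: complex and a :: "nat \<Rightarrow> nat"
  assumes mono: "strict_mono a" and a_0: "a 0 = 0"
    and x_sq: "\<And>j. x\<^sup>2 \<noteq> of_nat (a j)"
begin

text \<open>Multiplying the recurrence by the middle ratio makes consecutive products telescope.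
  Nonvanishing is proved alongside: a nonzero product forces its second factor to be nonzero. The
  entry \<open>a 0 = 0\<close> rules out \<open>x = 0\<close>.\<close>

lemma csik_ratio_step:
  "csik_ratio x a k \<noteq> 0 \<and>
   csik_ratio x a k * csik_ratio x a (Suc k) = x\<^sup>2 - of_nat (a (Suc k))"
proof (induction k)
  case 0
  have "x \<noteq> 0" using x_sq[of 0] a_0 by auto
  then show ?case by (simp add: field_simps power2_eq_square)
next
  case (Suc k)
  then have nz: "csik_ratio x a (Suc k) \<noteq> 0" using x_sq[of "Suc k"] by auto
  have "a (Suc k) \<le> a (Suc (Suc k))" using mono by (simp add: strict_mono_less_eq)
  then have "csik_ratio x a (Suc k) * csik_ratio x a (Suc (Suc k)) =
      csik_ratio x a k * csik_ratio x a (Suc k) - (of_nat (a (Suc (Suc k))) - of_nat (a (Suc k)))"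
    using nz by (simp add: field_simps of_nat_diff)
  then show ?case using nz Suc.IH by simp
qed

lemma csik_ratio_nonzero: "csik_ratio x a k \<noteq> 0"
  using csik_ratio_step by blast

lemma csik_ratio_mult_Suc:
  "csik_ratio x a k * csik_ratio x a (Suc k) = x\<^sup>2 - of_nat (a (Suc k))"
  using csik_ratio_step by blast

lemma has_ratio_csik: "has_ratio x (csik a k) (csik_ratio x a k)"
proof (induction k rule: induct_nat_012)
  case 0
  then show ?case using has_ratio_single by simp
next
  case 1
  have "x \<noteq> 0" using csik_ratio_nonzero[of 0] by simp
  then show ?case
    using has_ratio_graft_copies[OF ptree_single ptree_single has_ratio_single has_ratio_single]
    by simp
next
  case (ge2 k)
  then show ?case
    using has_ratio_graft_copies[OF ptree_csik ptree_csik ge2 csik_ratio_nonzero] by simp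
qed

end

text \<open>The shifted ratios have the same consecutive products as the original ones, so the
  correction factor inverts at every step. The equations are cleared of denominators.\<close>

lemma csik_ratio_prepend:
  fixes x :: complex
  assumes mono: "strict_mono a" and a_0: "a 0 = 0" and c: "0 < c" "c < a 1"
    and x_sq: "\<And>j. x\<^sup>2 \<noteq> of_nat (a j)" and x_c: "x\<^sup>2 \<noteq> of_nat c"
  shows "if even k then csik_ratio x (prepend c a) (Suc k) * x\<^sup>2 = csik_ratio x a k * (x\<^sup>2 - of_nat c)
    else csik_ratio x (prepend c a) (Suc k) * (x\<^sup>2 - of_nat c) = csik_ratio x a k * x\<^sup>2"
proof (induction k)
  case 0
  have "x \<noteq> 0" using x_sq[of 0] a_0 by auto
  then show ?case by (simp add: prepend_def field_simps power2_eq_square)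
next
  case (Suc k)
  let ?f = "csik_ratio x a" and ?g = "csik_ratio x (prepend c a)"
  have "x\<^sup>2 \<noteq> of_nat (prepend c a j)" for j
    using x_sq[of 0] x_sq[of "j - 1"] x_c a_0 by (auto simp: prepend_def)
  moreover have "prepend c a 0 = 0" "prepend c a (Suc (Suc k)) = a (Suc k)"
    by (simp_all add: prepend_def)
  ultimately have "?g (Suc k) * ?g (Suc (Suc k)) = x\<^sup>2 - of_nat (a (Suc k))"
    using csik_ratio_mult_Suc[OF strict_mono_prepend[OF mono c], of x "Suc k"]
    by (simp only: not_False_eq_True simp_thms)
  also have "\<dots> = ?f k * ?f (Suc k)" using csik_ratio_mult_Suc[OF mono a_0 x_sq] by simp
  finally have eq: "?g (Suc k) * ?g (Suc (Suc k)) = ?f k * ?f (Suc k)" .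
  have cross: "f * (g' * d) = f * (f' * e)" if "g * e = f * d" "g * g' = f * f'"
    for f f' g g' d e :: complex
  proof -
    have "f * (g' * d) = g * e * g'" unfolding that(1) by (simp only: ac_simps)
    also have "\<dots> = g * g' * e" by (simp only: ac_simps)
    finally show ?thesis unfolding that(2) by (simp only: ac_simps)
  qed
  have nz: "?f k \<noteq> 0" using csik_ratio_nonzero[OF mono a_0 x_sq] .
  show ?case
  proof (cases "even k")
    case True
    then have "?g (Suc k) * x\<^sup>2 = ?f k * (x\<^sup>2 - of_nat c)" using Suc.IH by simp
    then have "?f k * (?g (Suc (Suc k)) * (x\<^sup>2 - of_nat c)) = ?f k * (?f (Suc k) * x\<^sup>2)"
      by (rule cross[OF _ eq])
    then show ?thesis using nz True by simp
  next
    case False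
    then have "?g (Suc k) * (x\<^sup>2 - of_nat c) = ?f k * x\<^sup>2" using Suc.IH by simp
    then have "?f k * (?g (Suc (Suc k)) * x\<^sup>2) = ?f k * (?f (Suc k) * (x\<^sup>2 - of_nat c))"
      by (rule cross[OF _ eq])
    then show ?thesis using nz False by simp
  qed
qed

section \<open>Integral trees of odd diameter\<close>

text \<open>Every critical value of \<open>x\<^sup>2\<close> below is a perfect square, so this
  excludes them all for non-integral \<open>x\<close>.\<close>

lemma square_ne_if_not_int:
  fixes x :: complex
  assumes "x \<notin> \<int>"
  shows "x\<^sup>2 \<noteq> of_nat (k\<^sup>2)"
proof
  assume "x\<^sup>2 = of_nat (k\<^sup>2)"
  then have "x = of_nat k \<or> x = - of_nat k" by (simp add: power2_eq_iff)
  then show False using assms by auto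
qed

lemma exists_large_integral_tree:
  fixes n N :: nat
  assumes "n > 0" "even n"
  shows "\<exists>m\<ge>N. \<exists>E. is_tree m E \<and> integral_graph m E \<and> diameter m E = 2 * n + 1"
proof -
  obtain l where n: "n = Suc (Suc l)" and "even l"
    using assms by (metis even_Suc gr0_implies_Suc odd_pos)
  \<comment> \<open>The summand \<open>N\<close> makes the tree large; \<open>n\<close> and 5 leave
    room for \<open>Suc l\<close> squares that exceed \<open>b\<close> and end at
    \<open>A\<^sup>2\<close>.\<close>
  define k where "k = N + n + 5"
  define A where "A = k * (k + 1)"
  define B where "B = A - Suc l"
  define a where "a j = (if j = 0 then 0 else (B + j)\<^sup>2)" for j
  \<comment> \<open>Comparing coefficients for the roots 1 and \<open>(2 * A + 1)\<^sup>2\<close>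
    forces \<open>b = 4 * A + 1\<close> and the value of \<open>c\<close>; the choice of
    \<open>A\<close> makes \<open>b\<close> a square.\<close>
  define b where "b = (2 * k + 1)\<^sup>2"
  define c where "c = 3 * A\<^sup>2 + 4 * A - 3"
  have "5 * k \<le> k * k" by (rule mult_le_mono1) (simp add: k_def)
  then have "6 * k \<le> A" by (simp add: A_def)
  moreover have "Suc l < k" using n by (simp add: k_def)
  ultimately have B: "2 * k < B" "B + Suc l = A" unfolding B_def by linarith+
  have b: "b = 4 * A + 1" by (simp add: b_def A_def power2_eq_square algebra_simps)
  have A: "k \<le> A" "3 < A" using B by (auto simp: k_def)
  have a_0: "a 0 = 0" and a_Suc: "a (Suc l) = A\<^sup>2" using B(2) by (auto simp: a_def)
  have mono: "strict_mono a"
    unfolding strict_mono_Suc_iff by (auto simp: a_def intro!: power_strict_mono)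
  have "2\<^sup>2 < (B + 1)\<^sup>2" "(2 * k + 1)\<^sup>2 < (B + 1)\<^sup>2"
    using B(1) by (intro power_strict_mono; simp add: k_def)+
  then have c4: "0 < (4::nat)" "4 < a 1" and cb: "0 < b" "b < a 1" by (simp_all add: a_def b_def)
  have "A \<le> A\<^sup>2" by (simp add: power2_eq_square)
  then have c: "N \<le> c" "0 < c" "c + 3 = 3 * A\<^sup>2 + 4 * A"
    using A unfolding c_def by (auto simp: k_def)
  define U where "U = graft_copies c (csik (prepend 4 a) (Suc l)) (csik a (Suc l))"
  define V where "V = csik (prepend b a) (Suc (Suc l))"
  have U: "ptree U" and V: "ptree V"
    by (simp_all add: U_def V_def ptree_csik ptree_graft_copies del: csik.simps)
  have "has_depth U n"
    unfolding U_def n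
    by (rule has_depth_graft_copies[OF ptree_csik ptree_csik
          has_depth_csik[OF strict_mono_prepend[OF mono c4]] has_depth_csik[OF mono] _ c(2)]) simp
  moreover have "has_depth V n"
    unfolding V_def n by (intro has_depth_csik strict_mono_prepend mono cb)
  ultimately have diam: "diameter (fst (graft U V)) (tree_edge (graft U V)) = 2 * n + 1"
    by (rule diameter_graft[OF U V])
  have "x \<in> \<int>" if "eigenvalue (adj_matrix (fst (graft U V)) (tree_edge (graft U V))) x" for x
  proof (rule ccontr)
    assume x: "x \<notin> \<int>"
    note ne = square_ne_if_not_int[OF x]
    have x_sq: "x\<^sup>2 \<noteq> of_nat (a j)" for j using ne[of 0] ne[of "B + j"] by (simp add: a_def)
    have x_4: "x\<^sup>2 \<noteq> of_nat 4" using ne[of 2] by simp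
    have x_b: "x\<^sup>2 \<noteq> of_nat b" using ne unfolding b_def .
    have prep: "prepend c a 0 = 0" "(\<And>j. x\<^sup>2 \<noteq> of_nat (prepend c a j))"
      if "x\<^sup>2 \<noteq> of_nat c" for c
      using that x_sq a_0 x_sq[of 0] by (auto simp: prepend_def)
    let ?t = "x\<^sup>2" and ?f = "csik_ratio x a"
      and ?g = "csik_ratio x (prepend 4 a)" and ?h = "csik_ratio x (prepend b a)"
    have f_nz: "?f (Suc l) \<noteq> 0" using csik_ratio_nonzero[OF mono a_0 x_sq] .
    have h_nz: "?h n \<noteq> 0"
      using csik_ratio_nonzero[OF strict_mono_prepend[OF mono cb] prep[OF x_b]] .
    define \<rho> where "\<rho> = ?g (Suc l) - of_nat c / ?f (Suc l) - 1 / ?h n"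
    have "has_ratio x U (?g (Suc l) - of_nat c / ?f (Suc l))"
      unfolding U_def
      by (rule has_ratio_graft_copies[OF ptree_csik ptree_csik
            has_ratio_csik[OF strict_mono_prepend[OF mono c4] prep[OF x_4]]
            has_ratio_csik[OF mono a_0 x_sq] f_nz])
    moreover have "has_ratio x V (?h n)"
      unfolding V_def n
      by (rule has_ratio_csik[OF strict_mono_prepend[OF mono cb] prep[OF x_b]])
    ultimately have ratio: "has_ratio x (graft U V) \<rho>"
      unfolding \<rho>_def by (rule has_ratio_graft[OF U V _ _ h_nz])
    \<comment> \<open>Evenness of \<open>n\<close> enters here: index \<open>l\<close> is even and
      \<open>Suc l\<close> is odd, so the two prepended terms contribute opposite kinds of
      factor.\<close>
    have g: "?g (Suc l) * ?t = ?f l * (?t - 4)"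
      using csik_ratio_prepend[OF mono a_0 c4 x_sq x_4, of l] \<open>even l\<close>
      by (simp del: csik_ratio.simps)
    have h: "?h n * (?t - of_nat b) = ?f (Suc l) * ?t"
      using csik_ratio_prepend[OF mono a_0 cb x_sq x_b, of "Suc l"] \<open>even l\<close>
      by (simp add: n del: csik_ratio.simps)
    have f: "?f l * ?f (Suc l) = ?t - (of_nat A)\<^sup>2"
      using csik_ratio_mult_Suc[OF mono a_0 x_sq, of l] by (simp add: a_Suc del: csik_ratio.simps)
    \<comment> \<open>Multiplication by \<open>?t * ?f (Suc l)\<close> turns each of the three terms
      of \<open>\<rho>\<close> into a polynomial in \<open>?t\<close>.\<close>
    have "?t * ?f (Suc l) * (1 / ?h n) = ?t - of_nat b"
      using h h_nz by (simp add: field_simps)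
    moreover have "?t * ?f (Suc l) * (of_nat c / ?f (Suc l)) = of_nat c * ?t"
      using f_nz by simp
    moreover have "?t * ?f (Suc l) * ?g (Suc l) = (?t - (of_nat A)\<^sup>2) * (?t - 4)"
    proof -
      have "?t * ?f (Suc l) * ?g (Suc l) = ?f (Suc l) * (?g (Suc l) * ?t)" by (simp only: ac_simps)
      also have "\<dots> = ?f l * ?f (Suc l) * (?t - 4)" unfolding g by (simp only: ac_simps)
      finally show ?thesis unfolding f .
    qed
    ultimately have "?t * ?f (Suc l) * \<rho> =
        (?t - (of_nat A)\<^sup>2) * (?t - 4) - of_nat c * ?t - (?t - of_nat b)"
      unfolding \<rho>_def by (simp only: right_diff_distrib)
    \<comment> \<open>Writing \<open>c\<close> as \<open>(c + 3) - 3\<close> over the complex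
      numbers avoids the truncated subtraction in its definition.\<close>
    also have "\<dots> = (?t - (of_nat A)\<^sup>2) * (?t - 4) - (of_nat (c + 3) - 3) * ?t - (?t - of_nat b)"
      by simp
    also have "\<dots> = (?t - 1) * (?t - (2 * of_nat A + 1)\<^sup>2)"
      unfolding c(3) b by (simp add: algebra_simps power2_eq_square)
    also have "\<dots> \<noteq> 0" using ne[of 1] ne[of "2 * A + 1"] by (simp add: add.commute)
    finally have "\<rho> \<noteq> 0" by auto
    then show False using not_eigenvalue_if_has_ratio[OF ptree_graft[OF U V] ratio] that by blast
  qed
  then have "integral_graph (fst (graft U V)) (tree_edge (graft U V))"
    unfolding integral_graph_def by blast
  moreover have "N \<le> fst (graft U V)"
  proof -
    have "0 < fst (csik a (Suc l))" using ptree_csik[of a "Suc l"] by (simp add: ptree_def)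
    then have "c \<le> c * fst (csik a (Suc l))" by simp
    then show ?thesis using c(1) unfolding U_def fst_graft fst_graft_copies by linarith
  qed
  ultimately show ?thesis using is_tree_tree_edge[OF ptree_graft[OF U V]] diam by blast
qed

theorem theorem5:
  fixes n :: nat
  assumes "n > 0" and "even n"
  shows "\<exists>S :: (nat \<times> (nat \<Rightarrow> nat \<Rightarrow> bool)) set.
           infinite S \<and>
           (\<forall>(m, E) \<in> S. is_tree m E \<and> integral_graph m E \<and> diameter m E = 2 * n + 1) \<and>
           (\<forall>G \<in> S. \<forall>H \<in> S. G \<noteq> H \<longrightarrow> \<not> graph_iso G H)"
proof -
  define P where
    "P m E \<longleftrightarrow> is_tree m E \<and> integral_graph m E \<and> diameter m E = 2 * n + 1" for m E
  define M where "M = {m. \<exists>E. P m E}"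
  \<comment> \<open>One tree for each attained number of vertices, so that distinct members differ
    in size and cannot be isomorphic.\<close>
  define S where "S = (\<lambda>m. (m, SOME E. P m E)) ` M"
  have "infinite M"
    unfolding infinite_nat_iff_unbounded_le M_def P_def
    using exists_large_integral_tree[OF assms] by blast
  moreover have "inj_on (\<lambda>m. (m, SOME E. P m E)) M" by (rule inj_onI) simp
  ultimately have "infinite S" by (simp add: S_def finite_image_iff)
  moreover have "P m (SOME E. P m E)" if "m \<in> M" for m
    using someI_ex[of "P m"] that by (simp add: M_def)
  then have "\<forall>(m, E) \<in> S. P m E" by (auto simp: S_def)
  moreover have "\<not> graph_iso G H" if "G \<in> S" "H \<in> S" "G \<noteq> H" for G H
  proof
    assume "graph_iso G H"
    then have "fst G = fst H" by (auto simp: graph_iso_def dest: bij_betw_same_card)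
    then show False using that by (auto simp: S_def)
  qed
  ultimately show ?thesis unfolding P_def by blast
qed

end
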